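(* Let $t,r\ge1$ be integers and let $\mathcal{P}$ be the set of all partitions. Then, as formal power series in $z,s,q$, $$\sum_{\lambda\in\mathcal{P}} z^{\lambda_1}s^{|\lambda|}q^{\lambda_r+\lambda_{t+r}+\lambda_{2t+r}+\cdots}=\frac{1}{(sz;s)_{r-1}}\prod_{n=0}^\infty\frac{1}{(s^{nt+r}q^{n+1}z;s)_t}.$$
   Context: A partition is a weakly decreasing sequence of nonnegative integers $\lambda=(\lambda_1,\lambda_2,\dots)$, eventually zero, with $\lambda_i=0$ beyond the last nonzero part and $|\lambda|=\sum_i\lambda_i$. The $q$-Pochhammer symbol is $(a;s)_m=\prod_{k=0}^{m-1}(1-as^k)$ for integers $m\ge0$. *)

theory Defs
  imports
    "HOL-Analysis.Analysis"
    "HOL-Computational_Algebra.Formal_Power_Series"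
begin

definition partitions :: "(nat \<Rightarrow> nat) set" where
  "partitions = {p. antimono p \<and> eventually (\<lambda>i. p i = 0) sequentially}"

text \<open>
  The entries of a partition are stored from index 0 on, so the mathematical part
  $\lambda_i$ with $i \geq 1$ is \<open>ppart p i\<close>; the index \<open>i = 0\<close> is meaningless.
\<close>

definition ppart :: "(nat \<Rightarrow> nat) \<Rightarrow> nat \<Rightarrow> nat" where
  "ppart p i = p (i - 1)"

definition psize :: "(nat \<Rightarrow> nat) \<Rightarrow> nat" where
  "psize p = (\<Sum>i. ppart p (i + 1))"

definition qpochhammer :: "'a::comm_ring_1 \<Rightarrow> 'a \<Rightarrow> nat \<Rightarrow> 'a" where
  "qpochhammer a s m = (\<Prod>k<m. 1 - a * s ^ k)"

text \<open>
  Formal power series in \<open>z\<close>, \<open>s\<close>, \<open>q\<close> over a field are modelled by the iterated ring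
  $K[[q]][[z]][[s]]$. The indeterminate \<open>s\<close> is outermost because the library topology on
  \<open>fps\<close> is the adic one in the outermost indeterminate, with discrete coefficients: for each
  \<open>n\<close> there are only finitely many partitions of size \<open>n\<close>, so the sum over all partitions
  converges \<open>s\<close>-adically, whereas it would not converge \<open>z\<close>-adically or \<open>q\<close>-adically.
  Convergence in this topology implies convergence of every coefficient of
  $z^a s^b q^c$, so the limit is the usual formal one.
\<close>

type_synonym 'a fps3 = "'a fps fps fps"

definition var_s :: "'a::comm_ring_1 fps3" where
  "var_s = fps_X"

definition var_z :: "'a::comm_ring_1 fps3" where
  "var_z = fps_const fps_X"

definition var_q :: "'a::comm_ring_1 fps3" where
  "var_q = fps_const (fps_const fps_X)"

text \<open>
  The coefficients of the outermost level do not form a field, but the library division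
  still is the inverse in the ring for series whose \<open>s\<close>-constant term is 1.
\<close>

lemma fps3_divide_self:
  fixes f :: "'a::field fps3"
  assumes "fps_nth f 0 = 1"
  shows "(1 / f) * f = 1"
proof -
  have one: "inverse (1 :: 'a fps fps) = 1"
    by (simp add: fps_inverse_one')
  have sd: "subdegree f = 0"
    using assms by (intro subdegree_eq_0) simp
  have "f * inverse f = 1"
    unfolding fps_inverse_def using assms one by (intro fps_right_inverse) simp
  then show ?thesis
    by (simp add: fps_divide_def sd mult.commute)
qed

end

theory Submission
  imports Defs
begin

text \<open>
  Conjugation turns a partition into the sequence of its column multiplicities
  $\lambda_i - \lambda_{i+1}$, and all three statistics are additive in columns: a column of
  height $i$ contributes $z s^i q^{e_i}$, where $e_i$ counts the $n \geq 0$ with $nt + r \leq i$.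
  Splitting the partitions with at most $N + 1$ parts according to whether they contain a column
  of height $N + 1$ gives $G_{N+1} = G_N + z s^{N+1} q^{e_{N+1}} G_{N+1}$ for their generating
  functions, so $G_N \prod_{i \leq N} (1 - z s^i q^{e_i}) = 1$. Grouping the factors with
  $i \geq r$ into blocks of length $t$, on which $e_i$ is constant, and letting
  $N \to \infty$ gives the product formula.
\<close>

section \<open>Formal power series and infinite products\<close>

lemma tendsto_fps_mult_left:
  fixes f :: "'c \<Rightarrow> 'b::ring fps"
  assumes "(f \<longlongrightarrow> g) F"
  shows "((\<lambda>x. h * f x) \<longlongrightarrow> h * g) F"
proof (rule tendsto_fpsI)
  fix n
  have "\<forall>\<^sub>F x in F. \<forall>k\<in>{..n}. fps_nth (f x) k = fps_nth g k"
    using assms by (intro eventually_ball_finite) (auto simp: tendsto_fps_iff)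
  then show "\<forall>\<^sub>F x in F. fps_nth (h * f x) n = fps_nth (h * g) n"
    by eventually_elim (simp add: fps_mult_nth)
qed

lemma LIMSEQ_prod_imp_has_prod:
  assumes "(\<lambda>n. \<Prod>i<n. f i) \<longlonglongrightarrow> a" and "a \<noteq> 0"
  shows "f has_prod a"
proof -
  have "(\<lambda>n. \<Prod>i\<le>n. f i) \<longlonglongrightarrow> a"
    using LIMSEQ_Suc[OF assms(1)] by (simp only: lessThan_Suc_atMost)
  with \<open>a \<noteq> 0\<close> show ?thesis
    by (simp add: has_prod_def raw_has_prod_def)
qed

lemma prod_atLeastLessThan_blocks:
  fixes f :: "nat \<Rightarrow> 'b::comm_monoid_mult"
  shows "(\<Prod>n<M. \<Prod>i=a + n * t..<a + n * t + t. f i) = (\<Prod>i=a..<a + M * t. f i)"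
proof (induction M)
  case (Suc M)
  have "(\<Prod>i=a..<a + M * t. f i) * (\<Prod>i=a + M * t..<a + M * t + t. f i)
      = (\<Prod>i=a..<a + M * t + t. f i)"
    by (intro prod.atLeastLessThan_concat) simp_all
  with Suc.IH show ?case by (simp add: ac_simps)
qed simp

section \<open>Partitions with a bounded number of parts\<close>

definition partitions_upto :: "nat \<Rightarrow> (nat \<Rightarrow> nat) set" where
  "partitions_upto N = {p. antimono p \<and> (\<forall>i\<ge>N. p i = 0)}"

lemma partitions_upto_subset: "partitions_upto N \<subseteq> partitions"
  by (auto simp: partitions_upto_def partitions_def eventually_sequentially)

lemma partitions_upto_0: "partitions_upto 0 = {\<lambda>_. 0}"
  by (auto simp: partitions_upto_def antimono_def)

lemma psize_eq_suminf: "psize p = (\<Sum>i. p i)"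
  by (simp add: psize_def ppart_def)

lemma summable_partition_inj:
  assumes "p \<in> partitions" and "inj h"
  shows "summable (\<lambda>n. p (h n))"
proof -
  obtain N where "p i = 0" if "i \<ge> N" for i
    using assms(1) by (auto simp: partitions_def eventually_sequentially)
  moreover have "finite (h -` {..<N})"
    using assms(2) by (intro finite_vimageI) simp_all
  ultimately show ?thesis
    by (intro summable_finite[of "h -` {..<N}"]) auto
qed

lemma Suc_mult_part_le_psize:
  assumes "p \<in> partitions"
  shows "Suc i * p i \<le> psize p"
proof -
  have "Suc i * p i = (\<Sum>j\<le>i. p i)"
    by simp
  also have "\<dots> \<le> (\<Sum>j\<le>i. p j)"
    using assms by (intro sum_mono) (auto simp: partitions_def dest: antimonoD)
  also have "\<dots> \<le> psize p"
    unfolding psize_eq_suminf using summable_partition_inj[OF assms inj_on_id]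
    by (intro sum_le_suminf) simp_all
  finally show ?thesis .
qed

lemma partitions_upto_if_psize_le:
  assumes "p \<in> partitions" and "psize p \<le> N"
  shows "p \<in> partitions_upto N"
proof -
  have "p i = 0" if "i \<ge> N" for i
  proof (rule ccontr)
    assume "p i \<noteq> 0"
    then have "Suc i * 1 \<le> Suc i * p i"
      by (intro mult_le_mono2) simp
    also have "\<dots> \<le> psize p"
      using assms(1) by (rule Suc_mult_part_le_psize)
    finally show False
      using assms(2) that by simp
  qed
  with assms(1) show ?thesis
    by (simp add: partitions_def partitions_upto_def)
qed

lemma part_le_psize:
  assumes "p \<in> partitions"
  shows "p i \<le> psize p"
  using Suc_mult_part_le_psize[OF assms, of i] by simp

lemma finite_partitions_psize:
  assumes "A \<subseteq> partitions"
  shows "finite {p \<in> A. psize p = n}"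
proof (rule finite_subset)
  show "{p \<in> A. psize p = n}
      \<subseteq> {p. \<forall>i. (i \<in> {..<n} \<longrightarrow> p i \<in> {..n}) \<and> (i \<notin> {..<n} \<longrightarrow> p i = 0)}"
  proof (intro subsetI CollectI allI conjI impI)
    fix p i assume "p \<in> {p \<in> A. psize p = n}"
    then have partition: "p \<in> partitions" and psize: "psize p = n"
      using assms by auto
    then show "p i \<in> {..n}"
      using part_le_psize by blast
    show "p i = 0" if "i \<notin> {..<n}"
      using partitions_upto_if_psize_le[OF partition, of n] psize that
      by (simp add: partitions_upto_def)
  qed
qed (intro finite_set_of_finite_funs; simp)

section \<open>Adding a column\<close>

definition add_column :: "nat \<Rightarrow> (nat \<Rightarrow> nat) \<Rightarrow> nat \<Rightarrow> nat" where
  "add_column N p i = p i + of_bool (i < N)"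

lemma inj_add_column: "inj (add_column N)"
  by (auto simp: inj_def fun_eq_iff add_column_def)

lemma add_column_partitions_upto:
  assumes "p \<in> partitions_upto N"
  shows "add_column N p \<in> partitions_upto N"
  using assms by (auto simp: partitions_upto_def add_column_def antimono_def intro!: add_mono)

lemma suminf_add_column:
  assumes "p \<in> partitions" and "inj h"
  shows "(\<Sum>n. add_column N p (h n)) = (\<Sum>n. p (h n)) + card {n. h n < N}"
proof -
  have finite: "finite {n. h n < N}"
    using finite_vimageI[OF finite_lessThan assms(2)] by (simp add: vimage_def)
  have "(\<Sum>n. add_column N p (h n)) = (\<Sum>n. p (h n)) + (\<Sum>n. of_bool (h n < N))"
    unfolding add_column_def using finite
    by (intro suminf_add[symmetric] summable_partition_inj assms summable_finite[of "{n. h n < N}"])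
      simp_all
  also have "(\<Sum>n. of_bool (h n < N)) = card {n. h n < N}"
    using finite by (subst suminf_finite[of "{n. h n < N}"]) simp_all
  finally show ?thesis .
qed

lemma psize_add_column:
  assumes "p \<in> partitions"
  shows "psize (add_column N p) = psize p + N"
  using suminf_add_column[OF assms inj_on_id] by (simp add: psize_eq_suminf)

lemma partitions_upto_Suc_last_eq_0:
  "{p \<in> partitions_upto (Suc N). p N = 0} = partitions_upto N"
  by (auto simp: partitions_upto_def) (metis le_antisym not_less_eq_eq)

lemma partitions_upto_Suc_last_neq_0:
  "{p \<in> partitions_upto (Suc N). p N \<noteq> 0} = add_column (Suc N) ` partitions_upto (Suc N)"
proof (intro equalityI subsetI)
  fix p assume "p \<in> {p \<in> partitions_upto (Suc N). p N \<noteq> 0}"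
  then have antimono: "antimono p" and last: "p N > 0" and zero: "\<And>i. i > N \<Longrightarrow> p i = 0"
    by (auto simp: partitions_upto_def)
  define p' where "p' i = p i - of_bool (i \<le> N)" for i
  have "p' j \<le> p' i" if "i \<le> j" for i j
    using antimonoD[OF antimono that] that zero[of j]
    by (cases "j \<le> N") (auto simp: p'_def intro: diff_le_mono)
  then have "p' \<in> partitions_upto (Suc N)"
    using zero by (auto simp: partitions_upto_def p'_def antimono_def)
  moreover have "p i > 0" if "i \<le> N" for i
    using antimonoD[OF antimono that] last by linarith
  then have "p = add_column (Suc N) p'"
    by (auto simp: fun_eq_iff add_column_def p'_def)
  ultimately show "p \<in> add_column (Suc N) ` partitions_upto (Suc N)"
    by blast
next
  fix p assume "p \<in> add_column (Suc N) ` partitions_upto (Suc N)"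
  then show "p \<in> {p \<in> partitions_upto (Suc N). p N \<noteq> 0}"
    using add_column_partitions_upto by (auto simp: add_column_def)
qed

section \<open>Generating functions by size\<close>

definition size_gf :: "((nat \<Rightarrow> nat) \<Rightarrow> 'b::comm_monoid_add) \<Rightarrow> (nat \<Rightarrow> nat) set \<Rightarrow> 'b fps" where
  "size_gf w A = Abs_fps (\<lambda>n. \<Sum>p | p \<in> A \<and> psize p = n. w p)"

lemma size_gf_nth: "fps_nth (size_gf w A) n = (\<Sum>p | p \<in> A \<and> psize p = n. w p)"
  by (simp add: size_gf_def)

lemma size_gf_Un_disjoint:
  assumes "A \<subseteq> partitions" "B \<subseteq> partitions" "A \<inter> B = {}"
  shows "size_gf w (A \<union> B) = size_gf w A + size_gf w B"
proof (rule fps_ext)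
  fix n
  have "{p. p \<in> A \<union> B \<and> psize p = n} = {p \<in> A. psize p = n} \<union> {p \<in> B. psize p = n}"
    by auto
  then show "fps_nth (size_gf w (A \<union> B)) n = fps_nth (size_gf w A + size_gf w B) n"
    using finite_partitions_psize[OF assms(1)] finite_partitions_psize[OF assms(2)] assms(3)
    by (auto simp: size_gf_nth intro!: sum.union_disjoint)
qed

lemma size_gf_image:
  fixes w :: "(nat \<Rightarrow> nat) \<Rightarrow> 'b::semiring_1"
  assumes "inj_on f A"
    and psize: "\<And>p. p \<in> A \<Longrightarrow> psize (f p) = psize p + k"
    and weight: "\<And>p. p \<in> A \<Longrightarrow> w (f p) = c * w p"
  shows "size_gf w (f ` A) = fps_const c * fps_X ^ k * size_gf w A"
proof (rule fps_ext)
  fix n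
  have "{p. p \<in> f ` A \<and> psize p = n} = f ` {p \<in> A. psize p + k = n}"
    using psize by auto
  then have "fps_nth (size_gf w (f ` A)) n = (\<Sum>p\<in>f ` {p \<in> A. psize p + k = n}. w p)"
    by (simp only: size_gf_nth)
  also have "\<dots> = (\<Sum>p | p \<in> A \<and> psize p + k = n. c * w p)"
    using weight by (subst sum.reindex) (auto intro: inj_on_subset[OF assms(1)])
  also have "\<dots> = c * (\<Sum>p | p \<in> A \<and> psize p + k = n. w p)"
    by (rule sum_distrib_left[symmetric])
  also have "(\<Sum>p | p \<in> A \<and> psize p + k = n. w p) = fps_nth (fps_X ^ k * size_gf w A) n"
    by (auto simp: fps_X_power_mult_nth size_gf_nth intro!: sum.cong sum.neutral)
  finally show "fps_nth (size_gf w (f ` A)) n = fps_nth (fps_const c * fps_X ^ k * size_gf w A) n"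
    by (simp add: mult.assoc)
qed

lemma size_gf_partitions_upto_0: "size_gf w (partitions_upto 0) = fps_const (w (\<lambda>_. 0))"
proof (rule fps_ext)
  fix n
  have "{p \<in> partitions_upto 0. psize p = n} = (if n = 0 then {\<lambda>_. 0} else {})"
    by (auto simp: partitions_upto_0 psize_eq_suminf)
  then show "fps_nth (size_gf w (partitions_upto 0)) n = fps_nth (fps_const (w (\<lambda>_. 0))) n"
    by (simp add: size_gf_nth)
qed

lemma size_gf_partitions_upto_nth:
  assumes "n \<le> N"
  shows "fps_nth (size_gf w (partitions_upto N)) n = fps_nth (size_gf w partitions) n"
proof -
  have "{p \<in> partitions_upto N. psize p = n} = {p \<in> partitions. psize p = n}"
    using assms partitions_upto_subset partitions_upto_if_psize_le by auto
  then show ?thesis by (simp only: size_gf_nth)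
qed

lemma LIMSEQ_size_gf_partitions_upto:
  fixes w :: "(nat \<Rightarrow> nat) \<Rightarrow> 'b::ab_group_add"
  shows "(\<lambda>N. size_gf w (partitions_upto N)) \<longlonglongrightarrow> size_gf w partitions"
proof (rule tendsto_fpsI)
  fix n
  show "\<forall>\<^sub>F N in sequentially.
      fps_nth (size_gf w (partitions_upto N)) n = fps_nth (size_gf w partitions) n"
    using eventually_ge_at_top[of n] by eventually_elim (rule size_gf_partitions_upto_nth)
qed

lemma has_sum_size_gf:
  fixes w :: "(nat \<Rightarrow> nat) \<Rightarrow> 'b::comm_ring_1"
  assumes "A \<subseteq> partitions"
  shows "((\<lambda>p. fps_const (w p) * fps_X ^ psize p) has_sum size_gf w A) A"
  unfolding has_sum_def
proof (rule tendsto_fpsI)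
  fix n
  let ?A = "{p \<in> A. psize p = n}"
  have "fps_nth (\<Sum>p\<in>F. fps_const (w p) * fps_X ^ psize p) n = fps_nth (size_gf w A) n"
    if "finite F" "?A \<subseteq> F" "F \<subseteq> A" for F
  proof -
    have "fps_nth (\<Sum>p\<in>F. fps_const (w p) * fps_X ^ psize p) n
        = (\<Sum>p\<in>F. if psize p = n then w p else 0)"
      by (auto simp: fps_sum_nth intro!: sum.cong)
    also have "\<dots> = (\<Sum>p\<in>?A. w p)"
      using that by (intro sum.mono_neutral_cong_right) auto
    finally show ?thesis by (simp only: size_gf_nth)
  qed
  then show "\<forall>\<^sub>F F in finite_subsets_at_top A.
      fps_nth (\<Sum>p\<in>F. fps_const (w p) * fps_X ^ psize p) n = fps_nth (size_gf w A) n"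
    using finite_partitions_psize[OF assms]
    by (intro eventually_finite_subsets_at_top[THEN iffD2] exI[of _ ?A]) auto
qed

section \<open>Weights multiplicative in columns\<close>

definition euler_factor :: "(nat \<Rightarrow> 'b::comm_ring_1) \<Rightarrow> nat \<Rightarrow> 'b fps" where
  "euler_factor c i = 1 - fps_const (c i) * fps_X ^ i"

lemma prod_euler_factor_nth_0:
  assumes "0 \<notin> I"
  shows "fps_nth (\<Prod>i\<in>I. euler_factor c i) 0 = 1"
  using assms by (induction I rule: infinite_finite_induct) (auto simp: euler_factor_def)

lemma qpochhammer_eq_prod_euler_factor:
  assumes "\<And>i. i \<in> {j..<j + m} \<Longrightarrow> c i = d"
  shows "qpochhammer (fps_const d * fps_X ^ j) fps_X m = (\<Prod>i=j..<j + m. euler_factor c i)"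
  unfolding qpochhammer_def prod.atLeastLessThan_shift_0[of _ j] using assms
  by (intro prod.cong) (auto simp: euler_factor_def power_add mult.assoc)

locale column_multiplicative =
  fixes w :: "(nat \<Rightarrow> nat) \<Rightarrow> 'b::comm_ring_1" and c :: "nat \<Rightarrow> 'b"
  assumes weight_empty: "w (\<lambda>_. 0) = 1"
    and weight_add_column:
      "\<And>N p. N > 0 \<Longrightarrow> p \<in> partitions_upto N \<Longrightarrow> w (add_column N p) = c N * w p"
begin

lemma size_gf_partitions_upto_Suc:
  "size_gf w (partitions_upto (Suc N)) * euler_factor c (Suc N) = size_gf w (partitions_upto N)"
proof -
  let ?P = "partitions_upto (Suc N)"
  have "?P = partitions_upto N \<union> add_column (Suc N) ` ?P"
    and "partitions_upto N \<inter> add_column (Suc N) ` ?P = {}"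
    unfolding partitions_upto_Suc_last_eq_0[of N, symmetric]
      partitions_upto_Suc_last_neq_0[symmetric]
    by auto
  moreover have "add_column (Suc N) ` ?P \<subseteq> partitions"
    using add_column_partitions_upto partitions_upto_subset by blast
  ultimately have "size_gf w ?P
      = size_gf w (partitions_upto N) + size_gf w (add_column (Suc N) ` ?P)"
    using partitions_upto_subset size_gf_Un_disjoint by metis
  also have "size_gf w (add_column (Suc N) ` ?P)
      = fps_const (c (Suc N)) * fps_X ^ Suc N * size_gf w ?P"
    using partitions_upto_subset[of "Suc N"]
    by (intro size_gf_image inj_on_subset[OF inj_add_column] psize_add_column weight_add_column) auto
  finally have "size_gf w ?P - fps_const (c (Suc N)) * fps_X ^ Suc N * size_gf w ?P
      = size_gf w (partitions_upto N)"
    by (rule iffD2[OF diff_eq_eq])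
  then show ?thesis
    by (simp only: euler_factor_def right_diff_distrib mult_1_left mult.commute)
qed

lemma size_gf_partitions_upto_mult_prod:
  "size_gf w (partitions_upto N) * (\<Prod>i=1..<Suc N. euler_factor c i) = 1"
proof (induction N)
  case 0
  show ?case by (simp add: size_gf_partitions_upto_0 weight_empty)
next
  case (Suc N)
  have "size_gf w (partitions_upto (Suc N)) * (\<Prod>i=1..<Suc (Suc N). euler_factor c i)
      = size_gf w (partitions_upto (Suc N)) * euler_factor c (Suc N)
          * (\<Prod>i=1..<Suc N. euler_factor c i)"
    by (simp add: ac_simps)
  with Suc.IH show ?case
    by (simp only: size_gf_partitions_upto_Suc)
qed

lemma size_gf_partitions_nth_0: "fps_nth (size_gf w partitions) 0 = 1"
  using size_gf_partitions_upto_nth[of 0 0 w]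
  by (simp add: size_gf_partitions_upto_0 weight_empty)

lemma prod_inverse_blocks:
  assumes inverse: "\<And>n. f n * (\<Prod>i=r + n * t..<r + n * t + t. euler_factor c i) = 1" and "r \<ge> 1"
  shows "(\<Prod>n<M. f n)
    = (\<Prod>i=1..<r. euler_factor c i) * size_gf w (partitions_upto (r - 1 + M * t))"
proof -
  let ?A = "\<Prod>i=1..<r. euler_factor c i" and ?B = "\<Prod>i=r..<r + M * t. euler_factor c i"
  let ?G = "size_gf w (partitions_upto (r - 1 + M * t))"
  have "(\<Prod>n<M. f n) * ?B = 1"
    by (simp add: inverse flip: prod_atLeastLessThan_blocks prod.distrib)
  moreover have "?A * ?B = (\<Prod>i=1..<Suc (r - 1 + M * t). euler_factor c i)"
    using \<open>r \<ge> 1\<close> by (subst prod.atLeastLessThan_concat) simp_all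
  then have "?G * (?A * ?B) = 1"
    by (simp only: size_gf_partitions_upto_mult_prod)
  moreover have "(\<Prod>n<M. f n) * (?G * (?A * ?B)) = ?A * ?G * ((\<Prod>n<M. f n) * ?B)"
    by (simp only: ac_simps)
  ultimately show ?thesis
    by (simp only: mult_1_right)
qed

lemma has_prod_inverse_blocks:
  assumes "\<And>n. f n * (\<Prod>i=r + n * t..<r + n * t + t. euler_factor c i) = 1"
    and "t \<ge> 1" "r \<ge> 1"
  shows "f has_prod ((\<Prod>i=1..<r. euler_factor c i) * size_gf w partitions)"
proof (rule LIMSEQ_prod_imp_has_prod)
  let ?A = "\<Prod>i=1..<r. euler_factor c i"
  have "strict_mono (\<lambda>M. r - 1 + M * t)"
    using \<open>t \<ge> 1\<close> by (auto simp: strict_mono_def)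
  then have "(\<lambda>M. size_gf w (partitions_upto (r - 1 + M * t))) \<longlonglongrightarrow> size_gf w partitions"
    using LIMSEQ_subseq_LIMSEQ[OF LIMSEQ_size_gf_partitions_upto] by (simp add: comp_def)
  then show "(\<lambda>M. \<Prod>n<M. f n) \<longlonglongrightarrow> ?A * size_gf w partitions"
    unfolding prod_inverse_blocks[OF assms(1,3)] by (rule tendsto_fps_mult_left)
  have "fps_nth (?A * size_gf w partitions) 0 = 1"
    by (simp add: prod_euler_factor_nth_0 size_gf_partitions_nth_0)
  then show "?A * size_gf w partitions \<noteq> 0"
    by (metis fps_zero_nth zero_neq_one)
qed

end

section \<open>Parts along an arithmetic progression\<close>

definition progression_count :: "nat \<Rightarrow> nat \<Rightarrow> nat \<Rightarrow> nat" where
  "progression_count t r N = card {n. n * t + r \<le> N}"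

lemma progression_count_eq_0: "N < r \<Longrightarrow> progression_count t r N = 0"
  by (simp add: progression_count_def)

lemma progression_count_eq_div:
  assumes "t \<ge> 1" and "r \<le> N"
  shows "progression_count t r N = (N - r) div t + 1"
proof -
  have "{n. n * t + r \<le> N} = {..(N - r) div t}"
    using assms by (auto simp: less_eq_div_iff_mult_less_eq)
  then show ?thesis by (simp add: progression_count_def)
qed

lemma progression_sum_add_column:
  assumes "p \<in> partitions" and "t \<ge> 1" "r \<ge> 1"
  shows "(\<Sum>n. ppart (add_column N p) (n * t + r))
           = (\<Sum>n. ppart p (n * t + r)) + progression_count t r N"
proof -
  have inj: "inj (\<lambda>n. n * t + r - 1)"
  proof (rule injI)
    fix m n assume "m * t + r - 1 = n * t + r - 1"
    then have "m * t = n * t"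
      using \<open>r \<ge> 1\<close> by linarith
    then show "m = n"
      using \<open>t \<ge> 1\<close> by simp
  qed
  have "n * t + r - 1 < N \<longleftrightarrow> n * t + r \<le> N" for n
    using \<open>r \<ge> 1\<close> by auto
  then show ?thesis
    using suminf_add_column[OF assms(1) inj, of N]
    by (simp only: ppart_def progression_count_def)
qed

definition progression_weight :: "nat \<Rightarrow> nat \<Rightarrow> (nat \<Rightarrow> nat) \<Rightarrow> 'a::comm_ring_1 fps fps" where
  "progression_weight t r p = fps_X ^ ppart p 1 * fps_const fps_X ^ (\<Sum>n. ppart p (n * t + r))"

definition progression_column_weight :: "nat \<Rightarrow> nat \<Rightarrow> nat \<Rightarrow> 'a::comm_ring_1 fps fps" where
  "progression_column_weight t r N = fps_X * fps_const fps_X ^ progression_count t r N"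

lemma column_multiplicative_progression_weight:
  assumes "t \<ge> 1" "r \<ge> 1"
  shows "column_multiplicative (progression_weight t r) (progression_column_weight t r)"
proof
  show "progression_weight t r (\<lambda>_. 0) = 1"
    by (simp add: progression_weight_def ppart_def)
next
  fix N p assume "N > 0" and "p \<in> partitions_upto N"
  then have "ppart (add_column N p) 1 = Suc (ppart p 1)" and "p \<in> partitions"
    using partitions_upto_subset by (auto simp: ppart_def add_column_def)
  then show "progression_weight t r (add_column N p)
      = progression_column_weight t r N * progression_weight t r p"
    by (simp only: progression_weight_def progression_column_weight_def
        progression_sum_add_column[OF _ assms] power_Suc power_add mult_ac)
qed

lemma var_monomial_eq:
  "var_z ^ a * var_s ^ b * var_q ^ c
     = fps_const (fps_X ^ a * fps_const fps_X ^ c) * (fps_X ^ b :: 'a::comm_ring_1 fps3)"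
  unfolding var_z_def var_s_def var_q_def
  by (simp only: fps_const_power fps_const_mult[symmetric] mult_ac)

lemma qpochhammer_initial_eq_prod_euler_factor:
  assumes "r \<ge> 1"
  shows "qpochhammer (var_s * var_z) var_s (r - 1)
    = (\<Prod>i=1..<r. euler_factor (progression_column_weight t r :: nat \<Rightarrow> 'a::comm_ring_1 fps fps) i)"
proof -
  have weight: "progression_column_weight t r i = (fps_X :: 'a fps fps)"
    if "i \<in> {1..<1 + (r - 1)}" for i
  proof -
    have "progression_count t r i = 0"
      using that by (intro progression_count_eq_0) auto
    then show ?thesis
      by (simp add: progression_column_weight_def)
  qed
  show ?thesis
    using qpochhammer_eq_prod_euler_factor[of 1 "r - 1" "progression_column_weight t r", OF weight]
      assms
    by (simp add: var_s_def var_z_def mult.commute)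
qed

lemma qpochhammer_block_eq_prod_euler_factor:
  "qpochhammer (var_s ^ (n * t + r) * var_q ^ (n + 1) * var_z) var_s t
    = (\<Prod>i=r + n * t..<r + n * t + t.
        euler_factor (progression_column_weight t r :: nat \<Rightarrow> 'a::comm_ring_1 fps fps) i)"
proof -
  have weight: "progression_column_weight t r i = (fps_X * fps_const fps_X ^ (n + 1) :: 'a fps fps)"
    if "i \<in> {r + n * t..<r + n * t + t}" for i
  proof -
    have "(i - r) div t = n"
      using that by (intro div_nat_eqI) (auto simp: ac_simps)
    with that show ?thesis
      by (simp add: progression_column_weight_def progression_count_eq_div)
  qed
  have "var_s ^ (n * t + r) * var_q ^ (n + 1) * var_z
      = fps_const (fps_X * fps_const fps_X ^ (n + 1)) * (fps_X ^ (r + n * t) :: 'a fps3)"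
    using var_monomial_eq[of 1 "n * t + r" "n + 1"] by (simp only: power_one_right ac_simps)
  then show ?thesis
    using qpochhammer_eq_prod_euler_factor[OF weight] by (simp only: var_s_def)
qed

theorem theorem8:
  fixes t r :: nat
  assumes "t \<ge> 1" and "r \<ge> 1"
  shows "convergent_prod
           (\<lambda>n. 1 / qpochhammer (var_s ^ (n * t + r) * var_q ^ (n + 1) * var_z) var_s t
              :: 'a::field fps3)
       \<and> ((\<lambda>p. var_z ^ ppart p 1 * var_s ^ psize p * var_q ^ (\<Sum>n. ppart p (n * t + r)) :: 'a fps3)
           has_sum
             (1 / qpochhammer (var_s * var_z) var_s (r - 1)
               * (\<Prod>n. 1 / qpochhammer (var_s ^ (n * t + r) * var_q ^ (n + 1) * var_z) var_s t)))
           partitions"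
proof -
  let ?w = "progression_weight t r :: (nat \<Rightarrow> nat) \<Rightarrow> 'a fps fps"
  let ?E = "\<lambda>I. \<Prod>i\<in>I. euler_factor (progression_column_weight t r :: nat \<Rightarrow> 'a fps fps) i"
  let ?f = "\<lambda>n. 1 / ?E {r + n * t..<r + n * t + t}"
  interpret column_multiplicative ?w "progression_column_weight t r"
    using assms by (rule column_multiplicative_progression_weight)
  have prod_divide_self: "1 / ?E I * ?E I = 1" if "0 \<notin> I" for I
    using that by (intro fps3_divide_self prod_euler_factor_nth_0)
  have has_prod: "?f has_prod (?E {1..<r} * size_gf ?w partitions)"
    by (rule has_prod_inverse_blocks[OF prod_divide_self]) (use assms in auto)
  then have "convergent_prod ?f"
    by (auto simp: has_prod_def convergent_prod_def)
  have "1 / ?E {1..<r} * (\<Prod>n. ?f n) = 1 / ?E {1..<r} * ?E {1..<r} * size_gf ?w partitions"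
    by (simp only: has_prod_unique[OF has_prod, symmetric] mult.assoc)
  also have "\<dots> = size_gf ?w partitions"
    by (subst prod_divide_self) simp_all
  finally have product_eq: "1 / ?E {1..<r} * (\<Prod>n. ?f n) = size_gf ?w partitions" .
  show ?thesis
    unfolding qpochhammer_initial_eq_prod_euler_factor[OF assms(2), of t]
      qpochhammer_block_eq_prod_euler_factor var_monomial_eq product_eq
    using \<open>convergent_prod ?f\<close> has_sum_size_gf[OF order_refl, of ?w]
    by (simp only: progression_weight_def simp_thms)
qed

end
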